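(* Let $G$ be an $r$-regular graph. Then $\chi_{i}(G)=r$ if and only if $G$ is obtained from an $r$-partite graph $H$ with partite sets $H_{1},\dots,H_{r}$ such that (1) $|H_{1}|=\cdots=|H_{r}|\equiv 0 \pmod 2$, and (2) $[H_{i},H_{j}]$ is a perfect matching (between $H_i$ and $H_j$) for each $1\leq i\neq j\leq r$, by adding, for each $1\leq i\leq r$, the edges of a perfect matching on the vertices of $H_{i}$.
   Context: All graphs are finite and simple. An injective $k$-coloring function of a graph $G$ is a function $f:V(G)\to\{1,\dots,k\}$ such that no vertex $v$ is adjacent to two distinct vertices $u$ and $w$ with $f(u)=f(w)$ (adjacent vertices may receive the same color). The injective chromatic number $\chi_i(G)$ is the minimum $k$ for which $G$ admits an injective $k$-coloring function. For disjoint vertex subsets $A,B$ of a graph, $[A,B]$ denotes the set of all edges with one end-vertex in $A$ and the other in $B$. *)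

theory Defs
  imports "HOL-Library.Disjoint_Sets"
begin

record 'a ugraph =
  verts :: "'a set"
  edges :: "'a set set"

definition simple_graph :: "'a ugraph \<Rightarrow> bool" where
  "simple_graph G \<longleftrightarrow> finite (verts G) \<and> (\<forall>e\<in>edges G. e \<subseteq> verts G \<and> card e = 2)"

definition degree :: "'a ugraph \<Rightarrow> 'a \<Rightarrow> nat" where
  "degree G v = card {e \<in> edges G. v \<in> e}"

definition regular :: "nat \<Rightarrow> 'a ugraph \<Rightarrow> bool" where
  "regular r G \<longleftrightarrow> (\<forall>v\<in>verts G. degree G v = r)"

definition injective_coloring :: "'a ugraph \<Rightarrow> nat \<Rightarrow> ('a \<Rightarrow> nat) \<Rightarrow> bool" where
  "injective_coloring G k f \<longleftrightarrow>
     f ` verts G \<subseteq> {1..k} \<and>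
     (\<forall>v\<in>verts G. \<forall>u\<in>verts G. \<forall>w\<in>verts G.
        {v, u} \<in> edges G \<and> {v, w} \<in> edges G \<and> u \<noteq> w \<longrightarrow> f u \<noteq> f w)"

text \<open>The minimum below is attained for every finite graph, since a bijective numbering of the
  vertices is an injective coloring.\<close>

definition injective_chromatic_number :: "'a ugraph \<Rightarrow> nat" where
  "injective_chromatic_number G = (LEAST k. \<exists>f. injective_coloring G k f)"

definition edges_between :: "'a ugraph \<Rightarrow> 'a set \<Rightarrow> 'a set \<Rightarrow> 'a set set" where
  "edges_between G A B = {e \<in> edges G. \<exists>a\<in>A. \<exists>b\<in>B. e = {a, b}}"

definition perfect_matching_on :: "'a set \<Rightarrow> 'a set set \<Rightarrow> bool" where
  "perfect_matching_on S M \<longleftrightarrow> (\<forall>e\<in>M. card e = 2) \<and> disjoint M \<and> \<Union>M = S"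

definition partite_with :: "nat \<Rightarrow> 'a ugraph \<Rightarrow> (nat \<Rightarrow> 'a set) \<Rightarrow> bool" where
  "partite_with r H P \<longleftrightarrow>
     simple_graph H \<and>
     (\<Union>i\<in>{1..r}. P i) = verts H \<and>
     disjoint_family_on P {1..r} \<and>
     (\<forall>e\<in>edges H. \<forall>i\<in>{1..r}. \<not> e \<subseteq> P i)"

end

theory Submission
  imports Defs
begin

text \<open>In an injective coloring the colors on the neighbors of a vertex are pairwise distinct.
  So \<open>r\<close> colors suffice for an \<open>r\<close>-regular graph exactly if every vertex has one neighbor of each
  color; equivalently, the edges inside each color class and the edges between any two color
  classes form perfect matchings.\<close>

section \<open>Perfect matchings through the partners of single vertices\<close>

lemma card_2_other_element:
  assumes "card e = 2" and "v \<in> e"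
  obtains u where "e = {v, u}"
proof -
  from assms(1) obtain x y where "e = {x, y}" by (auto simp: card_2_iff)
  with assms(2) that show thesis by (cases "v = x") auto
qed

text \<open>For two-element edges inside \<open>S\<close>, covering \<open>S\<close> means that
  every vertex has a partner, and disjointness means that the partner is unique. In this pointwise
  form matchings can be read off from colored neighborhoods.\<close>

lemma perfect_matching_on_iff:
  "perfect_matching_on S M \<longleftrightarrow>
     (\<forall>e\<in>M. card e = 2 \<and> e \<subseteq> S) \<and> (\<forall>v\<in>S. \<exists>!u. {v, u} \<in> M)"
proof
  assume pm: "perfect_matching_on S M"
  have "\<exists>!u. {v, u} \<in> M" if "v \<in> S" for v
  proof -
    from pm that obtain e where e: "e \<in> M" "v \<in> e" "card e = 2"
      by (auto simp: perfect_matching_on_def)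
    then obtain u where u: "{v, u} \<in> M"
      by (metis card_2_other_element)
    have "w = u" if w: "{v, w} \<in> M" for w
    proof (rule ccontr)
      assume "w \<noteq> u"
      then have "{v, w} \<noteq> {v, u}" by (auto simp: doubleton_eq_iff)
      moreover have "disjoint M" using pm by (simp add: perfect_matching_on_def)
      ultimately have "{v, w} \<inter> {v, u} = {}" using u w disjointD by blast
      then show False by simp
    qed
    with u show ?thesis by blast
  qed
  with pm show "(\<forall>e\<in>M. card e = 2 \<and> e \<subseteq> S) \<and> (\<forall>v\<in>S. \<exists>!u. {v, u} \<in> M)"
    by (auto simp: perfect_matching_on_def)
next
  assume *: "(\<forall>e\<in>M. card e = 2 \<and> e \<subseteq> S) \<and> (\<forall>v\<in>S. \<exists>!u. {v, u} \<in> M)"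
  have "d = e" if de: "d \<in> M" "e \<in> M" and v: "v \<in> d" "v \<in> e" for d e v
  proof -
    obtain u where u: "d = {v, u}"
      using * de(1) v(1) card_2_other_element by metis
    obtain w where w: "e = {v, w}"
      using * de(2) v(2) card_2_other_element by metis
    have "v \<in> S" using * de(1) v(1) by blast
    with * u w de show ?thesis by blast
  qed
  then have "disjoint M" by (auto simp: disjoint_def)
  moreover have "\<Union>M = S" using * by blast
  ultimately show "perfect_matching_on S M"
    using * by (auto simp: perfect_matching_on_def)
qed

lemma perfect_matching_on_unique:
  assumes "perfect_matching_on S M" and "{v, u} \<in> M" and "{v, w} \<in> M"
  shows "u = w"
proof -
  have "v \<in> S" using assms by (auto simp: perfect_matching_on_def)
  with assms show ?thesis unfolding perfect_matching_on_iff by blast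
qed

text \<open>\<open>S\<close> is the disjoint union of the edges, so its size is a sum of
  twos.\<close>

lemma perfect_matching_on_even_card:
  assumes "perfect_matching_on S M"
  shows "even (card S)"
proof -
  have "card (\<Union>M) = sum card M"
    using assms by (intro card_Union_disjoint)
      (auto simp: perfect_matching_on_def intro: card_ge_0_finite)
  then show ?thesis
    using assms by (simp add: perfect_matching_on_def)
qed

section \<open>Neighborhoods, degrees and the minimum number of colors\<close>

lemma simple_graph_edgeD:
  assumes "simple_graph G" and "{v, u} \<in> edges G"
  shows "v \<in> verts G" and "u \<in> verts G" and "v \<noteq> u"
proof -
  have "{v, u} \<subseteq> verts G \<and> card {v, u} = 2"
    using assms unfolding simple_graph_def by blast
  then show "v \<in> verts G" "u \<in> verts G" "v \<noteq> u" by auto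
qed

text \<open>The map from \<open>u\<close> to \<open>{v, u}\<close> is a bijection from the neighbors
  of \<open>v\<close> to the edges at \<open>v\<close>. It turns the edge count into a count of
  vertices, which carry the colors.\<close>

lemma degree_eq_card_neighbors:
  assumes "simple_graph G"
  shows "degree G v = card {u. {v, u} \<in> edges G}"
proof -
  have "{e \<in> edges G. v \<in> e} = (\<lambda>u. {v, u}) ` {u. {v, u} \<in> edges G}"
  proof (intro equalityI subsetI)
    fix e assume e: "e \<in> {e \<in> edges G. v \<in> e}"
    then have "card e = 2" "v \<in> e" using assms by (auto simp: simple_graph_def)
    then obtain u where "e = {v, u}" by (rule card_2_other_element)
    with e show "e \<in> (\<lambda>u. {v, u}) ` {u. {v, u} \<in> edges G}" by auto
  qed auto
  moreover have "inj_on (\<lambda>u. {v, u}) {u. {v, u} \<in> edges G}"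
    by (auto simp: inj_on_def doubleton_eq_iff)
  ultimately show ?thesis by (simp add: degree_def card_image)
qed

lemma injective_coloringD:
  assumes "simple_graph G" and "injective_coloring G k f"
    and "{v, u} \<in> edges G" and "{v, w} \<in> edges G" and "f u = f w"
  shows "u = w"
proof -
  have "v \<in> verts G" "u \<in> verts G" "w \<in> verts G"
    using simple_graph_edgeD[OF assms(1,3)] simple_graph_edgeD[OF assms(1,4)] by simp_all
  with assms show ?thesis unfolding injective_coloring_def by blast
qed

lemma inj_on_neighbors:
  assumes "simple_graph G" and "injective_coloring G k f"
  shows "inj_on f {u. {v, u} \<in> edges G}"
proof (rule inj_onI)
  fix u w assume "u \<in> {u. {v, u} \<in> edges G}" "w \<in> {u. {v, u} \<in> edges G}" "f u = f w"
  then show "u = w" using injective_coloringD[OF assms] by simp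
qed

lemma neighbor_colors_subset:
  assumes "simple_graph G" and "injective_coloring G k f"
  shows "f ` {u. {v, u} \<in> edges G} \<subseteq> {1..k}"
proof -
  have "{u. {v, u} \<in> edges G} \<subseteq> verts G"
    using simple_graph_edgeD(2)[OF assms(1)] by blast
  then show ?thesis
    using assms(2) unfolding injective_coloring_def by blast
qed

lemma degree_le_if_injective_coloring:
  assumes "simple_graph G" and "injective_coloring G k f"
  shows "degree G v \<le> k"
proof -
  have "card {u. {v, u} \<in> edges G} \<le> card {1..k}"
    using inj_on_neighbors[OF assms] neighbor_colors_subset[OF assms]
    by (rule card_inj_on_le) simp
  then show ?thesis
    by (simp add: degree_eq_card_neighbors[OF assms(1)])
qed

text \<open>Pairwise distinct colors on all vertices give a witness, so that the
  \<open>LEAST\<close> in the chromatic number is attained.\<close>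

lemma ex_injective_coloring:
  assumes "simple_graph G"
  shows "\<exists>k f. injective_coloring G k f"
proof -
  have "finite (verts G)" using assms by (simp add: simple_graph_def)
  then obtain f where "bij_betw f (verts G) {1..card (verts G)}"
    using finite_same_card_bij[of "verts G" "{1..card (verts G)}"] by auto
  then have "injective_coloring G (card (verts G)) f"
    by (auto simp: injective_coloring_def bij_betw_def inj_on_def)
  then show ?thesis by blast
qed

lemma injective_chromatic_number_eq_iff:
  assumes "simple_graph G" and "verts G \<noteq> {}" and "regular r G"
  shows "injective_chromatic_number G = r \<longleftrightarrow> (\<exists>f. injective_coloring G r f)"
proof
  assume "injective_chromatic_number G = r"
  then show "\<exists>f. injective_coloring G r f"
    using LeastI_ex[OF ex_injective_coloring[OF assms(1)]]
    by (simp add: injective_chromatic_number_def)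
next
  assume f: "\<exists>f. injective_coloring G r f"
  \<comment> \<open>One vertex of degree \<open>r\<close> forces at least \<open>r\<close> colors.
    The empty graph is \<open>r\<close>-regular for every \<open>r\<close>, but its injective
    chromatic number is 0.\<close>
  obtain v where "v \<in> verts G" using assms(2) by blast
  then have "degree G v = r" using assms(3) by (simp add: regular_def)
  then show "injective_chromatic_number G = r"
    unfolding injective_chromatic_number_def
    using f degree_le_if_injective_coloring[OF assms(1)] by (blast intro: Least_equality)
qed

section \<open>From a coloring to matchings\<close>

text \<open>The \<open>r\<close> neighbors of \<open>v\<close> have distinct colors among
  \<open>r\<close> colors, so by counting every color occurs, and exactly once.\<close>

lemma ex1_neighbor_of_color:
  assumes "simple_graph G" and "regular r G" and "injective_coloring G r f"
    and "v \<in> verts G" and "i \<in> {1..r}"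
  shows "\<exists>!u. {v, u} \<in> edges G \<and> f u = i"
proof -
  let ?N = "{u. {v, u} \<in> edges G}"
  have "card (f ` ?N) = card {1..r}"
    using assms(2,4) inj_on_neighbors[OF assms(1,3)] degree_eq_card_neighbors[OF assms(1), of v]
    by (simp add: card_image regular_def)
  then have "f ` ?N = {1..r}"
    using neighbor_colors_subset[OF assms(1,3)] by (intro card_subset_eq) auto
  with assms(5) have "i \<in> f ` ?N" by simp
  then have "\<exists>u. {v, u} \<in> edges G \<and> f u = i" by auto
  then show ?thesis
    by (metis assms(1,3) injective_coloringD)
qed

text \<open>Sending each vertex of color \<open>i\<close> to a neighbor of color \<open>j\<close> is
  injective: two vertices with the same image would be equally colored neighbors of it. Exchanging
  \<open>i\<close> and \<open>j\<close> gives equal sizes.\<close>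

lemma color_class_card_le:
  assumes "simple_graph G" and "regular r G" and "injective_coloring G r f" and "j \<in> {1..r}"
  shows "card {v \<in> verts G. f v = i} \<le> card {v \<in> verts G. f v = j}"
proof -
  have "\<forall>v\<in>verts G. \<exists>u. {v, u} \<in> edges G \<and> f u = j"
    using ex1_neighbor_of_color[OF assms(1-3) _ assms(4)] by blast
  then obtain g where g: "\<And>v. v \<in> verts G \<Longrightarrow> {v, g v} \<in> edges G \<and> f (g v) = j"
    by metis
  have "inj_on g {v \<in> verts G. f v = i}"
  proof (rule inj_onI)
    fix v w
    assume "v \<in> {v \<in> verts G. f v = i}" "w \<in> {v \<in> verts G. f v = i}" "g v = g w"
    then show "v = w"
      using g[of v] g[of w] injective_coloringD[OF assms(1,3), of "g v" v w]
      by (simp add: insert_commute)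
  qed
  moreover have "g ` {v \<in> verts G. f v = i} \<subseteq> {v \<in> verts G. f v = j}"
    using g simple_graph_edgeD(2)[OF assms(1)] by blast
  ultimately show ?thesis
    using assms(1) by (intro card_inj_on_le) (auto simp: simple_graph_def)
qed

text \<open>The partner of a vertex is its unique neighbor of its own color.\<close>

lemma perfect_matching_on_color_class:
  assumes "simple_graph G" and "regular r G" and "injective_coloring G r f" and "i \<in> {1..r}"
  shows "perfect_matching_on {v \<in> verts G. f v = i}
           {e \<in> edges G. e \<subseteq> {v \<in> verts G. f v = i}}"
proof -
  have "\<exists>!u. {v, u} \<in> edges G \<and> {v, u} \<subseteq> {v \<in> verts G. f v = i}"
    if "v \<in> verts G" "f v = i" for v
    using ex1_neighbor_of_color[OF assms(1-3) that(1) assms(4)] that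
      simple_graph_edgeD(2)[OF assms(1)] by auto
  then show ?thesis
    using assms(1) unfolding perfect_matching_on_iff by (auto simp: simple_graph_def)
qed

text \<open>The partner of a vertex is its unique neighbor of the other of the two colors. The edge
  to it lies in no single class and therefore survives in \<open>H\<close>.\<close>

lemma perfect_matching_on_color_classes:
  assumes "simple_graph G" and "regular r G" and "injective_coloring G r f"
    and "i \<in> {1..r}" and "j \<in> {1..r}"
    and P: "P = (\<lambda>i. {v \<in> verts G. f v = i})"
    and H: "H = \<lparr>verts = verts G, edges = {e \<in> edges G. \<forall>i\<in>{1..r}. \<not> e \<subseteq> P i}\<rparr>"
    and "i \<noteq> j"
  shows "perfect_matching_on (P i \<union> P j) (edges_between H (P i) (P j))"
proof -
  have mem: "{v, u} \<in> edges_between H (P a) (P b) \<longleftrightarrow> {v, u} \<in> edges G \<and> f u = b"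
    if "v \<in> verts G" "f v = a" "a \<noteq> b" for v u a b
    using that simple_graph_edgeD(2)[OF assms(1)]
    by (auto simp: edges_between_def P H doubleton_eq_iff)
  \<comment> \<open>Edges are unordered, so \<open>mem\<close> with exchanged roles also serves the
    vertices of \<open>P j\<close>.\<close>
  have sym: "edges_between H (P j) (P i) = edges_between H (P i) (P j)"
    unfolding edges_between_def by (metis (lifting) insert_commute)
  have "\<exists>!u. {v, u} \<in> edges_between H (P i) (P j)" if v: "v \<in> P i \<union> P j" for v
  proof (cases "v \<in> P i")
    case True
    then have "v \<in> verts G" "f v = i" by (auto simp: P)
    then show ?thesis
      using ex1_neighbor_of_color[OF assms(1-3) _ assms(5)] mem[of v i j] \<open>i \<noteq> j\<close> by simp
  next
    case False
    with v have "v \<in> verts G" "f v = j" by (auto simp: P)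
    then show ?thesis
      using ex1_neighbor_of_color[OF assms(1-3) _ assms(4)] mem[of v j i] \<open>i \<noteq> j\<close>
      by (simp add: sym)
  qed
  moreover have "card e = 2 \<and> e \<subseteq> P i \<union> P j" if "e \<in> edges_between H (P i) (P j)" for e
    using that assms(1) by (auto simp: edges_between_def H simple_graph_def)
  ultimately show ?thesis
    unfolding perfect_matching_on_iff by blast
qed

section \<open>From matchings to a coloring, and the equivalence\<close>

text \<open>Each vertex is colored by the index of its part. Two neighbors of \<open>v\<close> in
  the same part are joined to \<open>v\<close> by edges of one matching, hence are equal.\<close>

lemma ex_injective_coloring_if_matchings:
  assumes H: "partite_with r H P"
    and between: "\<And>i j. i \<in> {1..r} \<Longrightarrow> j \<in> {1..r} \<Longrightarrow> i \<noteq> j \<Longrightarrow>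
      perfect_matching_on (P i \<union> P j) (edges_between H (P i) (P j))"
    and within: "\<And>i. i \<in> {1..r} \<Longrightarrow> perfect_matching_on (P i) (M i)"
    and G: "verts G = verts H" "edges G = edges H \<union> (\<Union>i\<in>{1..r}. M i)"
  shows "\<exists>f. injective_coloring G r f"
proof -
  have "\<forall>v\<in>verts G. \<exists>i\<in>{1..r}. v \<in> P i"
    using H G(1) unfolding partite_with_def by blast
  then obtain f where f: "\<And>v. v \<in> verts G \<Longrightarrow> f v \<in> {1..r}" "\<And>v. v \<in> verts G \<Longrightarrow> v \<in> P (f v)"
    by metis
  have P_eqD: "i = j" if "i \<in> {1..r}" "j \<in> {1..r}" "v \<in> P i" "v \<in> P j" for i j v
    using H that unfolding partite_with_def disjoint_family_on_def by blast
  have M_edge: "{v, u} \<subseteq> P k" if "k \<in> {1..r}" "{v, u} \<in> M k" for v u k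
    using within[OF that(1)] that(2) by (auto simp: perfect_matching_on_def)
  \<comment> \<open>An edge inside a part cannot come from the partite graph \<open>H\<close>, so it
    comes from some \<open>M k\<close>; disjointness of the parts leaves only
    \<open>k = f v\<close>.\<close>
  have same: "{v, u} \<in> M (f v)"
    if vu: "v \<in> verts G" "u \<in> verts G" "{v, u} \<in> edges G" "f u = f v" for v u
  proof -
    have "{v, u} \<subseteq> P (f v)" using f(2) that by force
    then have "{v, u} \<notin> edges H"
      using H f(1) that(1) unfolding partite_with_def by blast
    then obtain k where k: "k \<in> {1..r}" "{v, u} \<in> M k" using vu(3) G(2) by blast
    then have "k = f v" using M_edge[OF k] f[OF vu(1)] P_eqD by blast
    with k show ?thesis by simp
  qed
  have different: "{v, u} \<in> edges_between H (P (f v)) (P (f u))"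
    if vu: "v \<in> verts G" "u \<in> verts G" "{v, u} \<in> edges G" "f u \<noteq> f v" for v u
  proof -
    \<comment> \<open>An edge of \<open>M k\<close> has both ends in \<open>P k\<close>, hence ends
      of equal color.\<close>
    have "{v, u} \<notin> M k" if k: "k \<in> {1..r}" for k
    proof
      assume "{v, u} \<in> M k"
      from M_edge[OF k this] have "f v = k" "f u = k"
        using f[OF vu(1)] f[OF vu(2)] k P_eqD by blast+
      with \<open>f u \<noteq> f v\<close> show False by simp
    qed
    then have "{v, u} \<in> edges H" using vu(3) G(2) by blast
    then show ?thesis using f(2) vu(1,2) unfolding edges_between_def by blast
  qed
  have "u = w"
    if "v \<in> verts G" "u \<in> verts G" "w \<in> verts G" "{v, u} \<in> edges G" "{v, w} \<in> edges G" "f u = f w"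
    for v u w
  proof (cases "f u = f v")
    case True
    then show ?thesis
      using same[of v u] same[of v w] that within[OF f(1)] perfect_matching_on_unique by metis
  next
    case False
    then show ?thesis
      using different[of v u] different[of v w] that between[OF f(1) f(1), of v u]
        perfect_matching_on_unique by metis
  qed
  then have "injective_coloring G r f"
    using f(1) unfolding injective_coloring_def by blast
  then show ?thesis by blast
qed

theorem corollary4:
  fixes G :: "'a ugraph" and r :: nat
  assumes "simple_graph G" and "verts G \<noteq> {}" and "regular r G"
  shows "injective_chromatic_number G = r \<longleftrightarrow>
    (\<exists>(H :: 'a ugraph) (P :: nat \<Rightarrow> 'a set) (M :: nat \<Rightarrow> 'a set set).
       partite_with r H P \<and>
       (\<forall>i\<in>{1..r}. \<forall>j\<in>{1..r}. card (P i) = card (P j)) \<and>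
       (\<forall>i\<in>{1..r}. even (card (P i))) \<and>
       (\<forall>i\<in>{1..r}. \<forall>j\<in>{1..r}. i \<noteq> j \<longrightarrow>
          perfect_matching_on (P i \<union> P j) (edges_between H (P i) (P j))) \<and>
       (\<forall>i\<in>{1..r}. perfect_matching_on (P i) (M i)) \<and>
       verts G = verts H \<and>
       edges G = edges H \<union> (\<Union>i\<in>{1..r}. M i))"
proof -
  let ?matchings = "\<exists>(H :: 'a ugraph) (P :: nat \<Rightarrow> 'a set) (M :: nat \<Rightarrow> 'a set set).
       partite_with r H P \<and>
       (\<forall>i\<in>{1..r}. \<forall>j\<in>{1..r}. card (P i) = card (P j)) \<and>
       (\<forall>i\<in>{1..r}. even (card (P i))) \<and>
       (\<forall>i\<in>{1..r}. \<forall>j\<in>{1..r}. i \<noteq> j \<longrightarrow>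
          perfect_matching_on (P i \<union> P j) (edges_between H (P i) (P j))) \<and>
       (\<forall>i\<in>{1..r}. perfect_matching_on (P i) (M i)) \<and>
       verts G = verts H \<and>
       edges G = edges H \<union> (\<Union>i\<in>{1..r}. M i)"
  have "(\<exists>f. injective_coloring G r f) \<longleftrightarrow> ?matchings"
  proof
    assume "\<exists>f. injective_coloring G r f"
    then obtain f where f: "injective_coloring G r f" by blast
    define P where "P = (\<lambda>i. {v \<in> verts G. f v = i})"
    \<comment> \<open>The edges of \<open>G\<close> are split: those inside a color class go to
      \<open>M\<close>, all others form \<open>H\<close>.\<close>
    define M where "M = (\<lambda>i. {e \<in> edges G. e \<subseteq> P i})"
    define H :: "'a ugraph"
      where "H = \<lparr>verts = verts G, edges = {e \<in> edges G. \<forall>i\<in>{1..r}. \<not> e \<subseteq> P i}\<rparr>"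
    have "f ` verts G \<subseteq> {1..r}"
      using f by (simp add: injective_coloring_def)
    then have "partite_with r H P"
      using assms(1)
      by (auto simp: partite_with_def H_def P_def simple_graph_def disjoint_family_on_def)
    moreover have "\<forall>i\<in>{1..r}. \<forall>j\<in>{1..r}. card (P i) = card (P j)"
      using color_class_card_le[OF assms(1,3) f] unfolding P_def by (blast intro: antisym)
    moreover have M: "\<forall>i\<in>{1..r}. perfect_matching_on (P i) (M i)"
      using perfect_matching_on_color_class[OF assms(1,3) f] by (simp add: P_def M_def)
    moreover have "\<forall>i\<in>{1..r}. even (card (P i))"
      using M perfect_matching_on_even_card by blast
    moreover have "\<forall>i\<in>{1..r}. \<forall>j\<in>{1..r}. i \<noteq> j \<longrightarrow>
        perfect_matching_on (P i \<union> P j) (edges_between H (P i) (P j))"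
      using perfect_matching_on_color_classes[OF assms(1,3) f _ _ P_def H_def] by blast
    moreover have "verts G = verts H" "edges G = edges H \<union> (\<Union>i\<in>{1..r}. M i)"
      by (auto simp: H_def M_def)
    ultimately show ?matchings
      by blast
  next
    assume ?matchings
    then obtain H :: "'a ugraph" and P M where "partite_with r H P"
      and "\<forall>i\<in>{1..r}. \<forall>j\<in>{1..r}. i \<noteq> j \<longrightarrow>
        perfect_matching_on (P i \<union> P j) (edges_between H (P i) (P j))"
      and "\<forall>i\<in>{1..r}. perfect_matching_on (P i) (M i)"
      and "verts G = verts H" and "edges G = edges H \<union> (\<Union>i\<in>{1..r}. M i)"
      by (elim exE conjE) (rule that)
    then show "\<exists>f. injective_coloring G r f"
      by (intro ex_injective_coloring_if_matchings[of r H P M G]) simp_all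
  qed
  then show ?thesis
    by (simp only: injective_chromatic_number_eq_iff[OF assms])
qed

end
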